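(* Let $H$ be the four-cycle $C_4$ or its complement $\overline{C_4}$. Then there exists $\varepsilon>0$ such that for every $H$-free graph $G$ with $|G|>1$, there is a pure pair $(A,B)$ of subsets of $V(G)$ with $|A|\ge\varepsilon|G|^{\varepsilon}$ and $|B|\ge\varepsilon|G|$.
   Context: All graphs are finite with no loops or parallel edges; $|G|$ is the number of vertices of $G$. $G$ is $H$-free if no induced subgraph of $G$ is isomorphic to $H$. For disjoint $A,B\subseteq V(G)$, $A$ is complete to $B$ if every vertex of $A$ is adjacent to every vertex of $B$, and anticomplete to $B$ if there is no edge between $A$ and $B$. A pair $(A,B)$ of subsets of $V(G)$ is pure if $A\cap B=\emptyset$ and $A$ is either complete or anticomplete to $B$. *)

theory Defs
  imports Complex_Main
begin

datatype 'a ugraph = UGraph (verts: "'a set") (edges: "'a set set")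

definition finite_simple_graph :: "'a ugraph \<Rightarrow> bool" where
  "finite_simple_graph G \<longleftrightarrow>
     finite (verts G) \<and> edges G \<subseteq> {e. e \<subseteq> verts G \<and> card e = 2}"

definition adjacent :: "'a ugraph \<Rightarrow> 'a \<Rightarrow> 'a \<Rightarrow> bool" where
  "adjacent G u v \<longleftrightarrow> {u, v} \<in> edges G"

definition graph_complement :: "'a ugraph \<Rightarrow> 'a ugraph" where
  "graph_complement G =
     UGraph (verts G) ({e. e \<subseteq> verts G \<and> card e = 2} - edges G)"

definition induced_on :: "'a ugraph \<Rightarrow> 'a set \<Rightarrow> 'a ugraph" where
  "induced_on G X = UGraph X {e \<in> edges G. e \<subseteq> X}"

definition graph_iso :: "'a ugraph \<Rightarrow> 'b ugraph \<Rightarrow> bool" where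
  "graph_iso G H \<longleftrightarrow>
     (\<exists>f. bij_betw f (verts G) (verts H) \<and>
          (\<forall>u \<in> verts G. \<forall>v \<in> verts G. adjacent G u v \<longleftrightarrow> adjacent H (f u) (f v)))"

definition graph_free :: "'b ugraph \<Rightarrow> 'a ugraph \<Rightarrow> bool" where
  "graph_free H G \<longleftrightarrow> \<not> (\<exists>X \<subseteq> verts G. graph_iso (induced_on G X) H)"

text \<open>A simple graph only for \<open>n \<ge> 3\<close>.\<close>

definition cycle_graph :: "nat \<Rightarrow> nat ugraph" where
  "cycle_graph n = UGraph {..<n} ((\<lambda>i. {i, Suc i mod n}) ` {..<n})"

definition complete_to :: "'a ugraph \<Rightarrow> 'a set \<Rightarrow> 'a set \<Rightarrow> bool" where
  "complete_to G A B \<longleftrightarrow> (\<forall>a \<in> A. \<forall>b \<in> B. adjacent G a b)"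

definition anticomplete_to :: "'a ugraph \<Rightarrow> 'a set \<Rightarrow> 'a set \<Rightarrow> bool" where
  "anticomplete_to G A B \<longleftrightarrow> (\<forall>a \<in> A. \<forall>b \<in> B. \<not> adjacent G a b)"

definition pure_pair :: "'a ugraph \<Rightarrow> 'a set \<Rightarrow> 'a set \<Rightarrow> bool" where
  "pure_pair G A B \<longleftrightarrow>
     A \<subseteq> verts G \<and> B \<subseteq> verts G \<and> A \<inter> B = {} \<and>
     (complete_to G A B \<or> anticomplete_to G A B)"

end

theory Submission imports Defs begin

text \<open>
  Passing to the complement keeps pure pairs pure, so it is enough to treat graphs \<open>G\<close> without
  induced \<open>C\<^sub>4\<close>. Write \<open>n\<close> for the number of vertices and let \<open>t\<close> be a number with
  \<open>8192 t\<^sup>6 \<le> n\<close>; the claim is that some pure pair \<open>(A, B)\<close> has \<open>\<bar>A\<bar> \<ge> t\<close> and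
  \<open>\<bar>B\<bar> \<ge> n / 8192\<close> (\<open>uneven_pair_exists\<close>). A suitable \<open>t\<close> of order \<open>n powr \<epsilon>\<close> then gives the
  theorem. Assume that there is no such pair.

  Three consequences of \<open>C\<^sub>4\<close>-freeness drive the argument. The common neighbours of two
  nonadjacent vertices form a clique. A set with no large stable subset is a union of few cliques
  (\<open>clique_cover\<close>). Between two cliques the non-neighbourhoods are nested, so if there is no pair of
  anticomplete subsets of size \<open>t\<close>, then removing \<open>2t\<close> vertices makes the cliques complete to each
  other (\<open>cliques_almost_complete\<close>). Combining the last two, a set without two anticomplete
  subsets of size \<open>t\<close> is a clique apart from \<open>32 t\<^sup>5\<close> vertices (\<open>almost_clique\<close>).

  A clique of linear size splits into a pure pair, so all cliques are small, hence nonadjacent vertices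
  have few common neighbours. If half of all vertices had degree at least \<open>n / 16\<close>, they would contain
  no large stable set, because the neighbourhoods of its members would be large and almost disjoint;
  so they would be covered by boundedly many cliques, one of which is too large. Hence there is a set
  \<open>W\<close> of at least \<open>n / 2\<close> vertices of degree below \<open>n / 16\<close>, and from here on all neighbourhoods are
  taken within \<open>W\<close>.

  Consider the neighbourhood \<open>N\<close> of a vertex \<open>v\<close>, and suppose that \<open>A\<close> and \<open>A'\<close> are anticomplete subsets
  of \<open>N\<close> of size \<open>t\<close>. A vertex other than \<open>v\<close> outside \<open>N\<close> meets \<open>N\<close> in a clique, so it has no neighbour in \<open>A\<close> or none
  in \<open>A'\<close>, and one of the two sets is anticomplete to half of the rest of \<open>W\<close>. Therefore every
  neighbourhood is almost a clique (\<open>nbrs_almost_clique\<close>).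

  Finally take \<open>v\<close> of not too small degree and let \<open>K\<close> be the clique that makes up almost all of its
  neighbourhood. For \<open>u \<in> K\<close>, most neighbours of \<open>u\<close> outside \<open>K\<close> lie in one clique with most of \<open>K\<close>.
  So they belong to the set \<open>Q\<close> of vertices adjacent to half of \<open>K\<close>, which does not depend on \<open>u\<close> and
  is small by double counting. Any \<open>t\<close> vertices of \<open>K\<close> thus have all their neighbours in
  \<open>K \<union> Q\<close> and \<open>32 t\<^sup>6\<close> further vertices, and they are anticomplete to the rest of \<open>W\<close>.
\<close>

section \<open>Graphs without an induced four-cycle\<close>

lemma two_disjoint_subsets:
  assumes "2 * k \<le> card S"
  shows "\<exists>A B. A \<subseteq> S \<and> B \<subseteq> S \<and> A \<inter> B = {} \<and> card A = k \<and> card B = k"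
proof -
  obtain T where T: "T \<subseteq> S" "card T = 2 * k" "finite T"
    using obtain_subset_with_card_n[OF assms] by metis
  have "k \<le> card T" using T by simp
  then obtain A where A: "A \<subseteq> T" "card A = k" "finite A"
    using obtain_subset_with_card_n by metis
  have "card (T - A) = k" using A T by (simp add: card_Diff_subset)
  then show ?thesis using A T by (intro exI[of _ A] exI[of _ "T - A"]) auto
qed

text \<open>Adjacency is an arbitrary relation here, so that the locale can be interpreted both by the
  edges and by the non-edges of a graph.\<close>

locale c4_free =
  fixes V :: "'a set" and E :: "'a \<Rightarrow> 'a \<Rightarrow> bool"
  assumes finV: "finite V"
    and sym: "E x y \<Longrightarrow> E y x"
    and irrefl: "\<not> E x x"
    and chord: "\<lbrakk>a \<in> V; b \<in> V; c \<in> V; d \<in> V; a \<noteq> c; b \<noteq> d;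
      E a b; E b c; E c d; E d a\<rbrakk> \<Longrightarrow> E a c \<or> E b d"
begin

definition clique :: "'a set \<Rightarrow> bool" where
  "clique K \<longleftrightarrow> (\<forall>x\<in>K. \<forall>y\<in>K. x \<noteq> y \<longrightarrow> E x y)"

definition stable :: "'a set \<Rightarrow> bool" where
  "stable S \<longleftrightarrow> (\<forall>x\<in>S. \<forall>y\<in>S. \<not> E x y)"

definition apart :: "'a set \<Rightarrow> 'a set \<Rightarrow> bool" where
  "apart A B \<longleftrightarrow> (\<forall>a\<in>A. \<forall>b\<in>B. a \<noteq> b \<and> \<not> E a b)"

definition nbrs :: "'a set \<Rightarrow> 'a \<Rightarrow> 'a set" where
  "nbrs X v = {x \<in> X. E v x}"

lemma cliqueD: "clique K \<Longrightarrow> x \<in> K \<Longrightarrow> y \<in> K \<Longrightarrow> x \<noteq> y \<Longrightarrow> E x y"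
  by (simp add: clique_def)

lemma finite_sub: "X \<subseteq> V \<Longrightarrow> finite X"
  by (rule finite_subset[OF _ finV])

lemma common_nbrs_clique:
  assumes "x \<in> V" "y \<in> V" "x \<noteq> y" "\<not> E x y"
  shows "clique (nbrs V x \<inter> nbrs V y)"
  unfolding clique_def nbrs_def
proof (intro ballI impI)
  fix z w assume "z \<in> {u \<in> V. E x u} \<inter> {u \<in> V. E y u}"
    "w \<in> {u \<in> V. E x u} \<inter> {u \<in> V. E y u}" "z \<noteq> w"
  then show "E z w" using chord[of x z y w] assms sym by blast
qed

text \<open>Fix a maximum stable set \<open>S\<close>. A vertex with two neighbours in \<open>S\<close> lies in the common neighbourhood
  of a nonadjacent pair. The vertices whose only neighbour in \<open>S\<close> is \<open>x\<close> form a clique together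
  with \<open>x\<close>, since two nonadjacent ones could replace \<open>x\<close> and enlarge \<open>S\<close>. The cliques are
  indexed by \<open>S \<times> S\<close>, with the second kind on the diagonal.\<close>

lemma clique_cover:
  assumes X: "X \<subseteq> V"
    and bound: "\<And>S. S \<subseteq> X \<Longrightarrow> stable S \<Longrightarrow> card S \<le> s"
  shows "\<exists>(I :: ('a \<times> 'a) set) C. finite I \<and> card I \<le> s^2 \<and> X = (\<Union>i\<in>I. C i) \<and>
    (\<forall>i\<in>I. clique (C i))"
proof -
  have "stable {}" by (simp add: stable_def)
  then obtain S where S: "S \<subseteq> X" "stable S"
    and max: "\<And>T. T \<subseteq> X \<Longrightarrow> stable T \<Longrightarrow> card T \<le> card S"
    using Lattices_Big.ex_has_greatest_nat[of "\<lambda>S. S \<subseteq> X \<and> stable S" "{}" card "Suc s"] bound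
    by (auto simp: less_Suc_eq_le)
  have finS: "finite S" using S X finite_sub by blast
  define priv where "priv x = {z \<in> X. z = x \<or> (\<forall>y\<in>S. E z y \<longleftrightarrow> y = x)}" for x
  define C where "C p = (if fst p = snd p then priv (fst p)
      else nbrs V (fst p) \<inter> nbrs V (snd p) \<inter> X)" for p
  have priv: "clique (priv x)" if x: "x \<in> S" for x
    unfolding clique_def
  proof (intro ballI impI, rule ccontr)
    fix z w assume zw: "z \<in> priv x" "w \<in> priv x" "z \<noteq> w" and n: "\<not> E z w"
    have z: "z = x \<or> (\<forall>y\<in>S. E z y \<longleftrightarrow> y = x)" and w: "w = x \<or> (\<forall>y\<in>S. E w y \<longleftrightarrow> y = x)"
      using zw unfolding priv_def by auto
    have ne: "z \<noteq> x" "w \<noteq> x" using z w n x zw(3) sym[of w x] by auto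
    then have e: "E z x" "E w x" and zS: "\<And>y. y \<in> S - {x} \<Longrightarrow> \<not> E z y \<and> \<not> E w y"
      using z w x by auto
    have notS: "z \<notin> S" "w \<notin> S" using e x S(2) unfolding stable_def by auto
    let ?T = "insert z (insert w (S - {x}))"
    have "\<not> E w z" using n sym by blast
    moreover have "\<not> E y z \<and> \<not> E y w" if "y \<in> S - {x}" for y
      using zS[OF that] sym by blast
    ultimately have "stable ?T"
      using n zS S(2) irrefl unfolding stable_def by simp
    moreover have "?T \<subseteq> X" using zw S(1) unfolding priv_def by blast
    ultimately have "card ?T \<le> card S" using max by blast
    moreover have "card ?T = Suc (card S)"
      using finS x notS zw(3) card_Suc_Diff1[OF finS x] by simp
    ultimately show False by simp
  qed
  have cl: "clique (C p)" if "p \<in> S \<times> S" for p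
  proof (cases "fst p = snd p")
    case True
    then show ?thesis using priv that unfolding C_def by auto
  next
    case False
    have "fst p \<in> S" "snd p \<in> S" using that by auto
    then have "clique (nbrs V (fst p) \<inter> nbrs V (snd p))"
      using False S X unfolding stable_def by (intro common_nbrs_clique) auto
    then show ?thesis using False unfolding C_def clique_def by simp
  qed
  have "z \<in> (\<Union>p\<in>S \<times> S. C p)" if z: "z \<in> X" for z
  proof (cases "z \<in> S")
    case True
    then have "z \<in> C (z, z)" using z by (simp add: C_def priv_def)
    then show ?thesis using True by blast
  next
    case False
    have "\<exists>y\<in>S. E z y"
    proof (rule ccontr)
      assume "\<not> ?thesis"
      then have "stable (insert z S)"
        using S(2) sym irrefl unfolding stable_def by auto
      then have "card (insert z S) \<le> card S" using z S(1) by (intro max) auto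
      then show False using False finS by simp
    qed
    then obtain y where y: "y \<in> S" "E z y" by blast
    show ?thesis
    proof (cases "\<exists>y'\<in>S. y' \<noteq> y \<and> E z y'")
      case True
      then obtain y' where y': "y' \<in> S" "y' \<noteq> y" "E z y'" by blast
      then have "z \<in> C (y, y')" using y z X sym by (auto simp: C_def nbrs_def)
      then show ?thesis using y y' by blast
    next
      case False
      then have "z \<in> C (y, y)" using y z by (auto simp: C_def priv_def)
      then show ?thesis using y by blast
    qed
  qed
  moreover have "C p \<subseteq> X" for p unfolding C_def priv_def by auto
  ultimately have "X = (\<Union>p\<in>S \<times> S. C p)" by blast
  moreover have "card (S \<times> S) \<le> s^2"
    using bound[OF S] by (simp add: card_cartesian_product power2_eq_square mult_le_mono)
  ultimately show ?thesis
    using cl finS by (intro exI[of _ "S \<times> S"] exI[of _ C]) auto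
qed

text \<open>If \<open>d\<close> is missed by \<open>c\<close> only and \<open>d'\<close> by \<open>c'\<close> only, then \<open>c, c', d, d'\<close> is an induced four-cycle.
  The cliques may overlap.\<close>

lemma nonnbrs_nested:
  assumes "C \<subseteq> V" "D \<subseteq> V" "clique C" "clique D" "c \<in> C" "c' \<in> C"
  shows "{d \<in> D. d \<noteq> c \<and> \<not> E c d} \<subseteq> {d \<in> D. d \<noteq> c' \<and> \<not> E c' d} \<or>
    {d \<in> D. d \<noteq> c' \<and> \<not> E c' d} \<subseteq> {d \<in> D. d \<noteq> c \<and> \<not> E c d}"
proof (rule ccontr)
  assume "\<not> ?thesis"
  then obtain d d' where d: "d \<in> D" "d \<noteq> c" "\<not> E c d" "d = c' \<or> E c' d"
    and d': "d' \<in> D" "d' \<noteq> c'" "\<not> E c' d'" "d' = c \<or> E c d'" by blast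
  have "c \<noteq> c'" using d d' by blast
  then have cc: "E c c'" using assms unfolding clique_def by blast
  then have e: "E c' d" "E c d'" using d d' sym by blast+
  then have "d \<noteq> d'" using d by blast
  then have "E d d'" using assms d d' unfolding clique_def by blast
  then show False using chord[of c c' d d'] cc e d d' assms sym by blast
qed

text \<open>By nestedness, all vertices of \<open>C\<close> with at least \<open>t\<close> non-neighbours in \<open>D\<close> share the
  non-neighbours of the best among them, so there are fewer than \<open>t\<close> such vertices. The non-neighbours of
  all remaining vertices of \<open>C\<close> are contained in those of the worst one, fewer than \<open>t\<close> again.\<close>

lemma cliques_almost_complete:
  assumes sub: "C \<subseteq> V" "D \<subseteq> V" and cl: "clique C" "clique D"
    and no: "\<And>A B. A \<subseteq> C \<Longrightarrow> B \<subseteq> D \<Longrightarrow> apart A B \<Longrightarrow> card A < t \<or> card B < t"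
  shows "\<exists>R. finite R \<and> card R \<le> 2 * t \<and> (\<forall>c\<in>C - R. \<forall>d\<in>D - R. c \<noteq> d \<longrightarrow> E c d)"
proof -
  define miss where "miss c = {d \<in> D. d \<noteq> c \<and> \<not> E c d}" for c
  have fC: "finite C" and fD: "finite D" using sub finite_sub by auto
  have fm: "finite (miss c)" for c using fD unfolding miss_def by auto
  have nested: "miss c \<subseteq> miss c'" if "c \<in> C" "c' \<in> C" "card (miss c) \<le> card (miss c')" for c c'
  proof -
    have "miss c \<subseteq> miss c' \<or> miss c' \<subseteq> miss c"
      unfolding miss_def by (rule nonnbrs_nested[OF sub cl that(1,2)])
    then show ?thesis using card_seteq[OF fm _ that(3)] by auto
  qed
  define C' where "C' = {c \<in> C. t \<le> card (miss c)}"
  have cC': "card C' \<le> t"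
  proof (cases "C' = {}")
    case False
    then obtain c0 where c0: "c0 \<in> C'" "\<And>c. c \<in> C' \<Longrightarrow> card (miss c0) \<le> card (miss c)"
      using ex_has_least_nat[of "\<lambda>c. c \<in> C'" _ "\<lambda>c. card (miss c)"] by blast
    have "miss c0 \<subseteq> miss c" if "c \<in> C'" for c
      using nested c0 that unfolding C'_def by blast
    then have "apart C' (miss c0)" unfolding apart_def miss_def by blast
    then have "card C' < t \<or> card (miss c0) < t"
      by (intro no) (auto simp: C'_def miss_def)
    then show ?thesis using c0(1) unfolding C'_def by auto
  qed simp
  obtain D' where D': "finite D'" "card D' \<le> t" "\<And>c. c \<in> C - C' \<Longrightarrow> miss c \<subseteq> D'"
  proof (cases "C - C' = {}")
    case True
    then show ?thesis by (intro that[of "{}"]) auto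
  next
    case False
    then have "Max ((\<lambda>c. card (miss c)) ` (C - C')) \<in> (\<lambda>c. card (miss c)) ` (C - C')"
      using fC by (intro Max_in) auto
    then obtain c1 where c1: "c1 \<in> C - C'"
      "card (miss c1) = Max ((\<lambda>c. card (miss c)) ` (C - C'))" by auto
    have "card (miss c) \<le> card (miss c1)" if "c \<in> C - C'" for c
      using that fC c1(2) by simp
    then have "miss c \<subseteq> miss c1" if "c \<in> C - C'" for c using nested c1 that by blast
    moreover have "card (miss c1) \<le> t" using c1 unfolding C'_def by auto
    ultimately show ?thesis using that fm by blast
  qed
  have "card (C' \<union> D') \<le> 2 * t" using cC' D'(2) card_Un_le[of C' D'] by simp
  moreover have "E c d" if "c \<in> C - (C' \<union> D')" "d \<in> D - (C' \<union> D')" "c \<noteq> d" for c d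
    using D'(3)[of c] that unfolding miss_def by blast
  moreover have "finite (C' \<union> D')" using fC D' unfolding C'_def by auto
  ultimately show ?thesis by blast
qed

lemma stable_halves:
  assumes "stable S" "2 * k \<le> card S"
  shows "\<exists>A B. A \<subseteq> S \<and> B \<subseteq> S \<and> apart A B \<and> card A = k \<and> card B = k"
proof -
  from two_disjoint_subsets[OF assms(2)] obtain A B
    where AB: "A \<subseteq> S" "B \<subseteq> S" "A \<inter> B = {}" "card A = k" "card B = k" by blast
  have "apart A B"
    unfolding apart_def
  proof (intro ballI)
    fix a b assume "a \<in> A" "b \<in> B"
    then have "a \<in> S" "b \<in> S" "a \<noteq> b" using AB(1-3) by auto
    then show "a \<noteq> b \<and> \<not> E a b" using assms(1) unfolding stable_def by simp
  qed
  then show ?thesis using AB by (intro exI[of _ A] exI[of _ B]) simp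
qed

text \<open>A stable set of size \<open>2t\<close> would split into two sets that are apart, so \<open>X\<close> is covered by \<open>(2t)\<^sup>2\<close>
  cliques; merging each of the at most \<open>(2t)\<^sup>4\<close> pairs costs \<open>2t\<close> vertices.\<close>

lemma almost_clique:
  assumes X: "X \<subseteq> V"
    and no: "\<And>A B. A \<subseteq> X \<Longrightarrow> B \<subseteq> X \<Longrightarrow> apart A B \<Longrightarrow> card A < t \<or> card B < t"
  shows "\<exists>R. finite R \<and> card R \<le> 32 * t^5 \<and> clique (X - R)"
proof -
  have "card S \<le> 2 * t" if S: "S \<subseteq> X" "stable S" for S
  proof (rule ccontr)
    assume "\<not> ?thesis"
    then have "2 * t \<le> card S" by simp
    from stable_halves[OF S(2) this] obtain A B
      where AB: "A \<subseteq> S" "B \<subseteq> S" "apart A B" "card A = t" "card B = t" by blast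
    have "card A < t \<or> card B < t" using AB S(1) by (intro no) blast+
    then show False using AB by simp
  qed
  from clique_cover[OF X this] obtain I :: "('a \<times> 'a) set" and C
    where I: "finite I" "card I \<le> (2*t)^2" and XC: "X = (\<Union>i\<in>I. C i)"
      and cl: "\<And>i. i \<in> I \<Longrightarrow> clique (C i)" by blast
  have ex: "\<exists>R. finite R \<and> card R \<le> 2 * t \<and>
      (\<forall>c\<in>C (fst p) - R. \<forall>d\<in>C (snd p) - R. c \<noteq> d \<longrightarrow> E c d)" if p: "p \<in> I \<times> I" for p
  proof (rule cliques_almost_complete)
    have s: "C (fst p) \<subseteq> X" "C (snd p) \<subseteq> X" using p XC by auto
    then show "C (fst p) \<subseteq> V" "C (snd p) \<subseteq> V" using X by auto
    show "clique (C (fst p))" "clique (C (snd p))" using p cl by auto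
    show "card A < t \<or> card B < t" if "A \<subseteq> C (fst p)" "B \<subseteq> C (snd p)" "apart A B" for A B
      using no[of A B] s that by blast
  qed
  then obtain R where R: "\<And>p. p \<in> I \<times> I \<Longrightarrow> finite (R p) \<and> card (R p) \<le> 2 * t \<and>
      (\<forall>c\<in>C (fst p) - R p. \<forall>d\<in>C (snd p) - R p. c \<noteq> d \<longrightarrow> E c d)" by metis
  let ?R = "\<Union>p\<in>I \<times> I. R p"
  have "card ?R \<le> (\<Sum>p\<in>I \<times> I. card (R p))" using I by (intro card_UN_le) auto
  also have "\<dots> \<le> (\<Sum>p\<in>I \<times> I. 2 * t)" using R by (intro sum_mono) blast
  also have "\<dots> = card I * card I * (2 * t)" by (simp add: card_cartesian_product)
  also have "\<dots> \<le> (2*t)^2 * (2*t)^2 * (2 * t)" using I by (intro mult_le_mono) auto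
  also have "\<dots> = 32 * t^5" by algebra
  finally have "card ?R \<le> 32 * t^5" .
  moreover have "clique (X - ?R)"
    unfolding clique_def
  proof (intro ballI impI)
    fix x y assume xy: "x \<in> X - ?R" "y \<in> X - ?R" "x \<noteq> y"
    then obtain i j where ij: "i \<in> I" "j \<in> I" "x \<in> C i" "y \<in> C j" using XC by auto
    then have p: "(i, j) \<in> I \<times> I" by simp
    then have "x \<notin> R (i, j)" "y \<notin> R (i, j)" using xy by blast+
    then show "E x y" using R[OF p] ij xy(3) by auto
  qed
  moreover have "finite ?R" using I R by blast
  ultimately show ?thesis by blast
qed

section \<open>Sparsification\<close>

definition uneven_pair :: "nat \<Rightarrow> bool" where
  "uneven_pair t \<longleftrightarrow> (\<exists>A B. A \<subseteq> V \<and> B \<subseteq> V \<and> A \<inter> B = {} \<and>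
     ((\<forall>a\<in>A. \<forall>b\<in>B. E a b) \<or> (\<forall>a\<in>A. \<forall>b\<in>B. \<not> E a b)) \<and>
     t \<le> card A \<and> card V \<le> 8192 * card B)"

lemma uneven_pair_apart:
  assumes "A \<subseteq> V" "B \<subseteq> V" "apart A B" "t \<le> card A" "card V \<le> 8192 * card B"
  shows "uneven_pair t"
  unfolding uneven_pair_def using assms
  by (intro exI[of _ A] exI[of _ B]) (auto simp: apart_def)

lemma clique_small:
  assumes t: "1 \<le> t" "8192 * t^6 \<le> card V" and no: "\<not> uneven_pair t"
    and K: "K \<subseteq> V" "clique K"
  shows "2048 * card K < card V"
proof (rule ccontr)
  assume big: "\<not> ?thesis"
  define k where "k = card K div 2"
  have t6: "t \<le> t^6" "1 \<le> t^6" using t(1) by (auto intro: self_le_power)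
  have k: "card V \<le> 8192 * k" using big t t6 unfolding k_def by linarith
  have "2 * k \<le> card K" unfolding k_def by simp
  from two_disjoint_subsets[OF this] obtain A B
    where AB: "A \<subseteq> K" "B \<subseteq> K" "A \<inter> B = {}" "card A = k" "card B = k" by blast
  have "E a b" if "a \<in> A" "b \<in> B" for a b
  proof -
    have "a \<in> K" "b \<in> K" "a \<noteq> b" using that AB(1-3) by auto
    then show ?thesis using cliqueD[OF K(2)] by simp
  qed
  moreover have "t \<le> k" using k t t6 by linarith
  moreover have "A \<subseteq> V" "B \<subseteq> V" using AB K(1) by auto
  ultimately show False using no AB(3-5) k unfolding uneven_pair_def by metis
qed

text \<open>Among 33 pairwise nonadjacent vertices of degree at least \<open>n / 16\<close>, each shares fewer than
  \<open>32 n / 2048 = n / 64\<close> neighbours with the others. The private neighbourhoods \<open>P x\<close> are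
  disjoint and keep at least \<open>n / 32\<close> vertices each, more than \<open>n\<close> in total.\<close>

lemma stable_high_degree:
  assumes small: "\<And>K. K \<subseteq> V \<Longrightarrow> clique K \<Longrightarrow> 2048 * card K < card V"
    and S: "S \<subseteq> {v \<in> V. card V \<le> 16 * card (nbrs V v)}" "stable S"
  shows "card S \<le> 32"
proof (rule ccontr)
  assume "\<not> ?thesis"
  then have "33 \<le> card S" by simp
  then obtain T where T: "T \<subseteq> S" "card T = 33" "finite T"
    using obtain_subset_with_card_n by metis
  define P where "P x = nbrs V x - (\<Union>y\<in>T - {x}. nbrs V x \<inter> nbrs V y)" for x
  have fin: "finite (nbrs V x)" for x using finV unfolding nbrs_def by simp
  have P: "card V \<le> 32 * card (P x)" if x: "x \<in> T" for x
  proof -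
    let ?U = "\<Union>y\<in>T - {x}. nbrs V x \<inter> nbrs V y"
    have b: "2048 * card (nbrs V x \<inter> nbrs V y) \<le> card V" if y: "y \<in> T - {x}" for y
    proof -
      have "clique (nbrs V x \<inter> nbrs V y)"
        using x y T S by (intro common_nbrs_clique) (auto simp: stable_def)
      moreover have "nbrs V x \<inter> nbrs V y \<subseteq> V" unfolding nbrs_def by auto
      ultimately show ?thesis using small less_imp_le by blast
    qed
    have "card ?U \<le> (\<Sum>y\<in>T - {x}. card (nbrs V x \<inter> nbrs V y))"
      using T by (intro card_UN_le) auto
    then have "2048 * card ?U \<le> (\<Sum>y\<in>T - {x}. 2048 * card (nbrs V x \<inter> nbrs V y))"
      by (simp add: sum_distrib_left[symmetric])
    also have "\<dots> \<le> (\<Sum>y\<in>T - {x}. card V)" using b by (intro sum_mono) blast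
    also have "\<dots> = 32 * card V" using T x by simp
    finally have "2048 * card ?U \<le> 32 * card V" .
    moreover have "card V \<le> 16 * card (nbrs V x)" using x T S by blast
    moreover have "card (nbrs V x) \<le> card (P x) + card ?U"
      using diff_card_le_card_Diff[of ?U "nbrs V x"] T fin unfolding P_def by simp
    ultimately show ?thesis by linarith
  qed
  have "card (\<Union>x\<in>T. P x) = (\<Sum>x\<in>T. card (P x))"
  proof (rule card_UN_disjoint)
    show "\<forall>i\<in>T. finite (P i)" using fin unfolding P_def by simp
    show "\<forall>i\<in>T. \<forall>j\<in>T. i \<noteq> j \<longrightarrow> P i \<inter> P j = {}" unfolding P_def by blast
  qed (use T in simp)
  then have "32 * card (\<Union>x\<in>T. P x) = (\<Sum>x\<in>T. 32 * card (P x))"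
    by (simp add: sum_distrib_left)
  also have "\<dots> \<ge> (\<Sum>x\<in>T. card V)" using P by (intro sum_mono) blast
  finally have "33 * card V \<le> 32 * card (\<Union>x\<in>T. P x)" using T by simp
  moreover have "card (\<Union>x\<in>T. P x) \<le> card V"
    by (intro card_mono finV) (auto simp: P_def nbrs_def)
  ultimately have "card V = 0" by linarith
  then show False using small[of "{}"] by (simp add: clique_def)
qed

lemma few_high_degree:
  assumes small: "\<And>K. K \<subseteq> V \<Longrightarrow> clique K \<Longrightarrow> 2048 * card K < card V"
  shows "2 * card {v \<in> V. card V \<le> 16 * card (nbrs V v)} \<le> card V"
proof -
  define U where "U = {v \<in> V. card V \<le> 16 * card (nbrs V v)}"
  have UV: "U \<subseteq> V" unfolding U_def by blast
  have "card S \<le> 32" if "S \<subseteq> U" "stable S" for S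
    using stable_high_degree[OF small] that unfolding U_def by simp
  from clique_cover[OF UV this] obtain I :: "('a \<times> 'a) set" and C where I: "finite I" "card I \<le> 32^2"
    and U: "U = (\<Union>i\<in>I. C i)" and cl: "\<And>i. i \<in> I \<Longrightarrow> clique (C i)" by blast
  have "card (\<Union>i\<in>I. C i) \<le> (\<Sum>i\<in>I. card (C i))" using I by (intro card_UN_le) auto
  then have "2048 * card U \<le> (\<Sum>i\<in>I. 2048 * card (C i))"
    using U by (simp add: sum_distrib_left[symmetric])
  also have "\<dots> \<le> (\<Sum>i\<in>I. card V)"
  proof (rule sum_mono)
    fix i assume "i \<in> I"
    then have "C i \<subseteq> V" "clique (C i)" using U UV cl by auto
    then show "2048 * card (C i) \<le> card V" using small[of "C i"] by simp
  qed
  also have "\<dots> = card I * card V" by simp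
  also have "\<dots> \<le> 32^2 * card V" using I by (intro mult_le_mono) auto
  finally have "2 * card U \<le> card V" by simp
  then show ?thesis unfolding U_def .
qed

section \<open>Neighbourhoods in the sparse part\<close>

text \<open>If \<open>A\<close> and \<open>B\<close> are apart in the neighbourhood of \<open>v\<close>, then a non-neighbour \<open>x\<close> of \<open>v\<close> cannot see
  \<open>a \<in> A\<close> and \<open>b \<in> B\<close>, as \<open>v, a, x, b\<close> would be an induced four-cycle. So one of \<open>A\<close> and
  \<open>B\<close> is apart from half of the non-neighbours.\<close>

lemma nbrs_almost_clique:
  assumes t: "1 \<le> t" "8192 * t^6 \<le> card V" and no: "\<not> uneven_pair t"
    and WV: "W \<subseteq> V" and cW: "card V \<le> 2 * card W"
    and v: "v \<in> W" and deg: "16 * card (nbrs W v) \<le> card V"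
  shows "\<exists>R. finite R \<and> card R \<le> 32 * t^5 \<and> clique (nbrs W v - R)"
proof (rule almost_clique)
  have t6: "1 \<le> t^6" using t(1) by simp
  have fW: "finite W" using WV finite_sub by blast
  have fin: "finite (nbrs W v)" using fW unfolding nbrs_def by simp
  show "nbrs W v \<subseteq> V" using WV unfolding nbrs_def by blast
  show "card A < t \<or> card B < t" if AB: "A \<subseteq> nbrs W v" "B \<subseteq> nbrs W v" "apart A B" for A B
  proof (rule ccontr)
    assume big: "\<not> ?thesis"
    define M where "M = W - insert v (nbrs W v)"
    define M1 where "M1 = {x \<in> M. \<forall>a\<in>A. \<not> E x a}"
    define M2 where "M2 = {x \<in> M. \<forall>a\<in>B. \<not> E x a}"
    have ABW: "A \<subseteq> W" "B \<subseteq> W" using AB unfolding nbrs_def by auto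
    have "M \<subseteq> M1 \<union> M2"
    proof
      fix x assume x: "x \<in> M"
      show "x \<in> M1 \<union> M2"
      proof (rule ccontr)
        assume "x \<notin> M1 \<union> M2"
        then obtain a b where ab: "a \<in> A" "b \<in> B" "E x a" "E x b"
          using x unfolding M1_def M2_def by blast
        then have "E v a" "E v b" "a \<noteq> b" "\<not> E a b"
          using AB unfolding nbrs_def apart_def by blast+
        moreover have "v \<noteq> x" "\<not> E v x" "x \<in> V" using x WV unfolding M_def nbrs_def by auto
        ultimately show False using chord[of v a x b] ab ABW WV v sym by blast
      qed
    qed
    then have "card M \<le> card (M1 \<union> M2)"
      using fW by (intro card_mono) (auto simp: M_def M1_def M2_def)
    also have "\<dots> \<le> card M1 + card M2" by (rule card_Un_le)
    finally have M12: "card M \<le> card M1 + card M2" .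
    have "card (insert v (nbrs W v)) \<le> Suc (card (nbrs W v))"
      by (simp add: card_insert_if fin)
    then have "card W \<le> card M + Suc (card (nbrs W v))"
      using diff_card_le_card_Diff[of "insert v (nbrs W v)" W] fin unfolding M_def by simp
    then have "card V \<le> 8192 * card M1 \<or> card V \<le> 8192 * card M2"
      using M12 cW deg t t6 by linarith
    moreover have "apart A M1" "apart B M2"
      using AB sym unfolding apart_def M1_def M2_def M_def by blast+
    moreover have "M1 \<subseteq> V" "M2 \<subseteq> V" using WV unfolding M1_def M2_def M_def by auto
    moreover have "A \<subseteq> V" "B \<subseteq> V" using ABW WV by auto
    ultimately show False
      using no big uneven_pair_apart[of A M1 t] uneven_pair_apart[of B M2 t] by auto
  qed
qed

lemma uneven_pair_exists:
  assumes t: "1 \<le> t" "8192 * t^6 \<le> card V"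
  shows "uneven_pair t"
proof (rule ccontr)
  assume no: "\<not> uneven_pair t"
  note small = clique_small[OF t no]
  define W where "W = {v \<in> V. 16 * card (nbrs V v) < card V}"
  define r where "r = 32 * t^5"
  have t6: "t \<le> t^6" "1 \<le> t^6" "r * t = 32 * t^6" "t \<le> r" "1 \<le> r"
  proof -
    show "t \<le> t^6" using self_le_power[of t 6] t(1) by simp
    show "1 \<le> t^6" using t(1) by simp
    show "r * t = 32 * t^6" using power_Suc[of t 5] unfolding r_def by (simp add: mult.commute)
    show "t \<le> r" using self_le_power[of t 5] t(1) unfolding r_def by simp
    then show "1 \<le> r" using t(1) by simp
  qed
  have WV: "W \<subseteq> V" unfolding W_def by blast
  have fW: "finite W" using WV finite_sub by blast
  have cW: "card V \<le> 2 * card W"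
  proof -
    have "W = V - {v \<in> V. card V \<le> 16 * card (nbrs V v)}" unfolding W_def by auto
    then have "card W = card V - card {v \<in> V. card V \<le> 16 * card (nbrs V v)}"
      using finV by (simp add: card_Diff_subset)
    then show ?thesis using few_high_degree[OF small] by linarith
  qed
  have deg: "16 * card (nbrs W v) \<le> card V" if "v \<in> W" for v
  proof -
    have "card (nbrs W v) \<le> card (nbrs V v)"
      using WV finV by (intro card_mono) (auto simp: nbrs_def)
    then show ?thesis using that unfolding W_def by auto
  qed
  have fin: "finite (nbrs W v)" for v using fW unfolding nbrs_def by simp
  have near: "\<exists>R. finite R \<and> card R \<le> r \<and> clique (nbrs W v - R)" if v: "v \<in> W" for v
    unfolding r_def by (rule nbrs_almost_clique[OF t no WV cW v deg[OF v]])
  \<comment> \<open>Otherwise any \<open>t\<close> vertices have at most \<open>3 r t = 96 t\<^sup>6\<close> neighbours altogether.\<close>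
  have "\<exists>v\<in>W. 3 * r \<le> card (nbrs W v)"
  proof (rule ccontr)
    assume low: "\<not> ?thesis"
    have "t \<le> card W" using cW t t6 by linarith
    then obtain A where A: "A \<subseteq> W" "card A = t" "finite A"
      using obtain_subset_with_card_n by metis
    define Z where "Z = A \<union> (\<Union>a\<in>A. nbrs W a)"
    have "card (\<Union>a\<in>A. nbrs W a) \<le> (\<Sum>a\<in>A. card (nbrs W a))"
      using A by (intro card_UN_le) auto
    also have "\<dots> \<le> (\<Sum>a\<in>A. 3 * r)"
      using low A by (intro sum_mono) (meson less_imp_le not_le subsetD)
    also have "\<dots> = 3 * (32 * t^6)" using A t6 by (simp add: mult.commute)
    finally have "card Z \<le> t + 96 * t^6"
      using card_Un_le[of A "\<Union>a\<in>A. nbrs W a"] A unfolding Z_def by simp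
    moreover have "finite Z" using A fin unfolding Z_def by blast
    ultimately have "card V \<le> 8192 * card (W - Z)"
      using diff_card_le_card_Diff[of Z W] cW t t6 by linarith
    moreover have "apart A (W - Z)" unfolding apart_def Z_def nbrs_def by blast
    ultimately show False
      using no uneven_pair_apart[of A "W - Z" t] A WV by (metis Diff_subset order.refl order.trans)
  qed
  then obtain v where v: "v \<in> W" "3 * r \<le> card (nbrs W v)" by blast
  obtain R0 where R0: "finite R0" "card R0 \<le> r" "clique (nbrs W v - R0)"
    using near[OF v(1)] by blast
  define K where "K = nbrs W v - R0"
  have KW: "K \<subseteq> W" and fK: "finite K" using fin unfolding K_def nbrs_def by auto
  have clK: "clique K" using R0(3) unfolding K_def .
  have cK: "2 * r \<le> card K"
    using diff_card_le_card_Diff[of R0 "nbrs W v"] R0 v unfolding K_def by linarith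
  have cK': "16 * card K \<le> card V"
  proof -
    have "card K \<le> card (nbrs W v)" using fin by (intro card_mono) (auto simp: K_def)
    then show ?thesis using deg[OF v(1)] by linarith
  qed
  obtain R where R: "\<And>u. u \<in> W \<Longrightarrow> finite (R u) \<and> card (R u) \<le> r \<and> clique (nbrs W u - R u)"
    using near by metis
  define Q where "Q = {w \<in> W. card K \<le> 2 * card (nbrs K w)}"
  have fQ: "finite Q" using fW unfolding Q_def by simp
  \<comment> \<open>Edges between \<open>Q\<close> and \<open>K\<close>: at least \<open>\<bar>Q\<bar> \<bar>K\<bar> / 2\<close>, at most \<open>\<bar>K\<bar> n / 16\<close>.\<close>
  have cQ: "8 * card Q \<le> card V"
  proof -
    have "card Q * card K \<le> (\<Sum>w\<in>Q. 2 * card (nbrs K w))"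
      using sum_mono[of Q "\<lambda>_. card K" "\<lambda>w. 2 * card (nbrs K w)"] by (simp add: Q_def)
    also have "\<dots> = 2 * (\<Sum>w\<in>Q. card (nbrs K w))" by (simp add: sum_distrib_left)
    also have "(\<Sum>w\<in>Q. card (nbrs K w)) = (\<Sum>u\<in>K. card {w \<in> Q. E w u})"
      unfolding nbrs_def using sum_multicount_gen[OF fQ fK, of E] by simp
    also have "\<dots> \<le> (\<Sum>u\<in>K. card (nbrs W u))"
      using fin sym by (intro sum_mono card_mono) (auto simp: Q_def nbrs_def)
    finally have "card Q * card K \<le> 2 * (\<Sum>u\<in>K. card (nbrs W u))" by simp
    then have "8 * (card Q * card K) \<le> 16 * (\<Sum>u\<in>K. card (nbrs W u))" by linarith
    also have "\<dots> = (\<Sum>u\<in>K. 16 * card (nbrs W u))" by (rule sum_distrib_left)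
    also have "\<dots> \<le> (\<Sum>u\<in>K. card V)" using deg KW by (intro sum_mono) blast
    finally have "card K * (8 * card Q) \<le> card K * card V" by (simp add: algebra_simps)
    then show ?thesis using cK t6 by simp
  qed
  have nbrs_sub: "nbrs W u \<subseteq> K \<union> Q \<union> R u" if u: "u \<in> K" for u
  proof
    fix w assume w: "w \<in> nbrs W u"
    show "w \<in> K \<union> Q \<union> R u"
    proof (rule ccontr)
      assume "w \<notin> K \<union> Q \<union> R u"
      then have wn: "w \<notin> K" "w \<notin> Q" "w \<notin> R u" by auto
      have uW: "u \<in> W" using u KW by blast
      \<comment> \<open>\<open>w\<close> lies in the clique \<open>nbrs W u - R u\<close>, which contains all of \<open>K - R u\<close> except \<open>u\<close>.\<close>
      have "K - R u \<subseteq> nbrs K w"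
      proof
        fix x assume x: "x \<in> K - R u"
        show "x \<in> nbrs K w"
        proof (cases "x = u")
          case True
          then show ?thesis using w u sym unfolding nbrs_def by blast
        next
          case False
          then have "E u x" using u x by (intro cliqueD[OF clK]) auto
          then have "x \<in> nbrs W u - R u" using x KW unfolding nbrs_def by auto
          moreover have "w \<in> nbrs W u - R u" "w \<noteq> x" using w wn x by auto
          moreover have "clique (nbrs W u - R u)" using R[OF uW] by simp
          ultimately have "E w x" by (intro cliqueD[of "nbrs W u - R u"])
          then show ?thesis using x unfolding nbrs_def by simp
        qed
      qed
      then have "card (K - R u) \<le> card (nbrs K w)"
        using fK by (intro card_mono) (auto simp: nbrs_def)
      moreover have "card K - card (R u) \<le> card (K - R u)"
        using diff_card_le_card_Diff R[OF uW] by blast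
      moreover have "card (R u) \<le> r" using R[OF uW] by blast
      ultimately have "card K \<le> 2 * card (nbrs K w)" using cK by linarith
      then show False using wn(2) w unfolding Q_def nbrs_def by blast
    qed
  qed
  have "t \<le> card K" using cK t6 by linarith
  then obtain A where A: "A \<subseteq> K" "card A = t" "finite A"
    using obtain_subset_with_card_n by metis
  define Z where "Z = K \<union> Q \<union> (\<Union>u\<in>A. R u)"
  have "card (\<Union>u\<in>A. R u) \<le> (\<Sum>u\<in>A. card (R u))" using A by (intro card_UN_le) auto
  also have "\<dots> \<le> (\<Sum>u\<in>A. r)" using R A KW by (intro sum_mono) blast
  also have "\<dots> = 32 * t^6" using A t6 by (simp add: mult.commute)
  finally have "card Z \<le> card K + card Q + 32 * t^6"
    using card_Un_le[of "K \<union> Q" "\<Union>u\<in>A. R u"] card_Un_le[of K Q] unfolding Z_def by linarith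
  moreover have "finite Z" using A R KW fK fQ unfolding Z_def by blast
  ultimately have "card V \<le> 8192 * card (W - Z)"
    using diff_card_le_card_Diff[of Z W] cW cK' cQ t t6 by linarith
  moreover have "apart A (W - Z)"
    unfolding apart_def
  proof (intro ballI)
    fix a b assume ab: "a \<in> A" "b \<in> W - Z"
    then show "a \<noteq> b \<and> \<not> E a b"
      using nbrs_sub[of a] A unfolding Z_def nbrs_def by blast
  qed
  ultimately show False
    using no uneven_pair_apart[of A "W - Z" t] A KW WV by (metis Diff_subset order.refl order.trans)
qed

end

section \<open>Transfer to graphs\<close>

lemma cycle_graph_4_adjacent:
  "adjacent (cycle_graph 4) i j \<longleftrightarrow> {i, j} \<in> {{0, 1}, {1, 2}, {2, 3}, {3, 0}}"
proof -
  have "{..<4::nat} = {0, 1, 2, 3}" by auto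
  then have "edges (cycle_graph 4) = {{0, 1}, {1, 2}, {2, 3}, {3, 0}}"
    by (simp add: cycle_graph_def numeral_2_eq_2[symmetric])
  then show ?thesis by (simp add: adjacent_def)
qed

lemma induced_c4:
  assumes X: "{a, b, c, d} \<subseteq> verts G" and ne: "distinct [a, b, c, d]"
    and H: "verts H = {..<4}"
    and adj: "\<And>i j. i < 4 \<Longrightarrow> j < 4 \<Longrightarrow>
      adjacent G ([a, b, c, d] ! i) ([a, b, c, d] ! j) = adjacent H i j"
  shows "\<not> graph_free H G"
proof -
  let ?xs = "[a, b, c, d]"
  define f where "f = the_inv_into {..<4} ((!) ?xs)"
  have bij: "bij_betw ((!) ?xs) {..<4} {a, b, c, d}"
    using bij_betw_nth[OF ne, of "{..<4}" "{a, b, c, d}"] by simp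
  have fb: "bij_betw f {a, b, c, d} {..<4}"
    unfolding f_def by (rule bij_betw_the_inv_into[OF bij])
  have inv: "?xs ! f x = x" if "x \<in> {a, b, c, d}" for x
    unfolding f_def by (rule f_the_inv_into_f_bij_betw[OF bij]) (use that in blast)
  have lt: "f x < 4" if "x \<in> {a, b, c, d}" for x
    using fb that unfolding bij_betw_def by blast
  have "adjacent (induced_on G {a, b, c, d}) u v = adjacent H (f u) (f v)"
    if uv: "u \<in> {a, b, c, d}" "v \<in> {a, b, c, d}" for u v
  proof -
    have "adjacent (induced_on G {a, b, c, d}) u v = adjacent G u v"
      using uv by (simp add: adjacent_def induced_on_def)
    also have "\<dots> = adjacent H (f u) (f v)"
      using adj[OF lt lt, OF uv] inv uv by simp
    finally show ?thesis .
  qed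
  then have "graph_iso (induced_on G {a, b, c, d}) H"
    unfolding graph_iso_def using fb H by (intro exI[of _ f]) (simp add: induced_on_def)
  then show ?thesis unfolding graph_free_def using X by blast
qed

lemma adjacent_commute: "adjacent G u v \<longleftrightarrow> adjacent G v u"
  by (simp add: adjacent_def insert_commute)

lemma adjacent_irrefl: "finite_simple_graph G \<Longrightarrow> \<not> adjacent G u u"
proof
  assume "finite_simple_graph G" "adjacent G u u"
  then have "card {u, u} = 2" unfolding finite_simple_graph_def adjacent_def by fast
  then show False by simp
qed

lemma less_4_cases: "(i::nat) < 4 \<Longrightarrow> i = 0 \<or> i = 1 \<or> i = 2 \<or> i = 3"
  by linarith

lemma c4_free_adjacent:
  assumes G: "finite_simple_graph G" "graph_free (cycle_graph 4) G"
  shows "c4_free (verts G) (adjacent G)"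
proof
  show "finite (verts G)" using G by (simp add: finite_simple_graph_def)
  fix a b c d
  assume v: "a \<in> verts G" "b \<in> verts G" "c \<in> verts G" "d \<in> verts G" and ne: "a \<noteq> c" "b \<noteq> d"
    and e: "adjacent G a b" "adjacent G b c" "adjacent G c d" "adjacent G d a"
  show "adjacent G a c \<or> adjacent G b d"
  proof (rule ccontr)
    assume n: "\<not> ?thesis"
    note irr = adjacent_irrefl[OF G(1)]
    have dist: "distinct [a, b, c, d]" using ne e irr by auto
    have "\<not> graph_free (cycle_graph 4) G"
    proof (rule induced_c4[OF _ dist])
      show "{a, b, c, d} \<subseteq> verts G" using v by simp
      show "verts (cycle_graph 4) = {..<4}" by (simp add: cycle_graph_def)
      fix i j :: nat assume ij: "i < 4" "j < 4"
      show "adjacent G ([a, b, c, d] ! i) ([a, b, c, d] ! j) = adjacent (cycle_graph 4) i j"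
        using less_4_cases[OF ij(1)] less_4_cases[OF ij(2)] e n
        by (elim disjE) (simp_all add: cycle_graph_4_adjacent doubleton_eq_iff irr
            adjacent_commute[of G _ a] adjacent_commute[of G d c] adjacent_commute[of G d b]
            adjacent_commute[of G c b] numeral_2_eq_2 numeral_3_eq_3)
    qed
    then show False using G by simp
  qed
qed (simp_all add: adjacent_commute adjacent_irrefl[OF G(1)])

lemma c4_free_nonadjacent:
  assumes G: "finite_simple_graph G" "graph_free (graph_complement (cycle_graph 4)) G"
  shows "c4_free (verts G) (\<lambda>u v. u \<noteq> v \<and> \<not> adjacent G u v)"
proof
  show "finite (verts G)" using G by (simp add: finite_simple_graph_def)
  fix a b c d
  assume v: "a \<in> verts G" "b \<in> verts G" "c \<in> verts G" "d \<in> verts G" and ne: "a \<noteq> c" "b \<noteq> d"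
    and e: "a \<noteq> b \<and> \<not> adjacent G a b" "b \<noteq> c \<and> \<not> adjacent G b c"
      "c \<noteq> d \<and> \<not> adjacent G c d" "d \<noteq> a \<and> \<not> adjacent G d a"
  show "(a \<noteq> c \<and> \<not> adjacent G a c) \<or> (b \<noteq> d \<and> \<not> adjacent G b d)"
  proof (rule ccontr)
    assume n: "\<not> ?thesis"
    note irr = adjacent_irrefl[OF G(1)]
    have dist: "distinct [a, b, c, d]" using ne e by auto
    have "\<not> graph_free (graph_complement (cycle_graph 4)) G"
    proof (rule induced_c4[OF _ dist])
      show "{a, b, c, d} \<subseteq> verts G" using v by simp
      show "verts (graph_complement (cycle_graph 4)) = {..<4}"
        by (simp add: cycle_graph_def graph_complement_def)
      fix i j :: nat assume ij: "i < 4" "j < 4"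
      have "adjacent (graph_complement (cycle_graph 4)) i j
          \<longleftrightarrow> i \<noteq> j \<and> \<not> adjacent (cycle_graph 4) i j"
        using ij by (auto simp: adjacent_def graph_complement_def cycle_graph_def)
      then show "adjacent G ([a, b, c, d] ! i) ([a, b, c, d] ! j)
          = adjacent (graph_complement (cycle_graph 4)) i j"
        using less_4_cases[OF ij(1)] less_4_cases[OF ij(2)] e n ne
        by (elim disjE) (simp_all add: cycle_graph_4_adjacent doubleton_eq_iff irr
            adjacent_commute[of G _ a] adjacent_commute[of G d c] adjacent_commute[of G d b]
            adjacent_commute[of G c b] numeral_2_eq_2 numeral_3_eq_3)
    qed
    then show False using G by simp
  qed
qed (auto simp: adjacent_commute)

lemma pure_pair_if_free:
  assumes G: "finite_simple_graph G"
    and H: "graph_free (cycle_graph 4) G \<or> graph_free (graph_complement (cycle_graph 4)) G"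
    and t: "1 \<le> t" "8192 * t^6 \<le> card (verts G)"
  shows "\<exists>A B. pure_pair G A B \<and> t \<le> card A \<and> card (verts G) \<le> 8192 * card B"
  using H
proof
  assume "graph_free (cycle_graph 4) G"
  then interpret c4_free "verts G" "adjacent G" by (rule c4_free_adjacent[OF G])
  from uneven_pair_exists[OF t] show ?thesis
    unfolding uneven_pair_def pure_pair_def complete_to_def anticomplete_to_def by blast
next
  assume "graph_free (graph_complement (cycle_graph 4)) G"
  then interpret c4_free "verts G" "\<lambda>u v. u \<noteq> v \<and> \<not> adjacent G u v"
    by (rule c4_free_nonadjacent[OF G])
  from uneven_pair_exists[OF t] obtain A B where AB: "A \<subseteq> verts G" "B \<subseteq> verts G" "A \<inter> B = {}"
    "(\<forall>a\<in>A. \<forall>b\<in>B. a \<noteq> b \<and> \<not> adjacent G a b) \<or> (\<forall>a\<in>A. \<forall>b\<in>B. \<not> (a \<noteq> b \<and> \<not> adjacent G a b))"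
    "t \<le> card A" "card (verts G) \<le> 8192 * card B"
    unfolding uneven_pair_def by blast
  then have "a \<noteq> b" if "a \<in> A" "b \<in> B" for a b
    using that by blast
  then have "complete_to G A B \<or> anticomplete_to G A B"
    using AB(4) unfolding complete_to_def anticomplete_to_def by meson
  then have "pure_pair G A B"
    using AB(1-3) unfolding pure_pair_def by simp
  then show ?thesis using AB by blast
qed

text \<open>The constants come from \<open>8192 (2 n powr \<epsilon>)\<^sup>6 \<le> 8192 \<cdot> 64 \<cdot> sqrt n\<close>, which needs \<open>6 \<epsilon> \<le> 1 / 2\<close>, and
  from \<open>64 \<cdot> 8192 \<le> sqrt n\<close>.\<close>

lemma sixth_power_bound:
  fixes n :: nat and \<epsilon> :: real
  assumes e: "0 < \<epsilon>" "\<epsilon> \<le> 1 / 12" and n: "(64 * 8192)^2 \<le> real n"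
    and t: "real t \<le> 1 + real n powr \<epsilon>"
  shows "8192 * t^6 \<le> n"
proof -
  have n1: "1 \<le> real n" using n by simp
  have "1 \<le> real n powr \<epsilon>" using n1 e by (simp add: ge_one_powr_ge_zero)
  then have "real t \<le> 2 * real n powr \<epsilon>" using t by simp
  then have "real t ^ 6 \<le> (2 * real n powr \<epsilon>) ^ 6" by (intro power_mono) auto
  also have "\<dots> = 64 * real n powr (6 * \<epsilon>)"
    using n1 by (simp add: power_mult_distrib powr_power mult.commute)
  also have "\<dots> \<le> 64 * real n powr (1 / 2)" using e n1 by (intro mult_left_mono powr_mono) auto
  also have "\<dots> = 64 * sqrt (real n)" using n1 by (simp add: powr_half_sqrt)
  finally have "8192 * real t ^ 6 \<le> (64 * 8192) * sqrt (real n)" by simp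
  also have "\<dots> \<le> sqrt (real n) * sqrt (real n)"
    using real_le_rsqrt[OF n] by (intro mult_right_mono) auto
  finally have "real (8192 * t^6) \<le> real n" by simp
  then show ?thesis by (simp only: of_nat_le_iff)
qed

theorem mainTheorem3:
  fixes H :: "nat ugraph"
  assumes "H = cycle_graph 4 \<or> H = graph_complement (cycle_graph 4)"
  shows "\<exists>\<epsilon>::real. \<epsilon> > 0 \<and>
    (\<forall>G :: 'a ugraph. finite_simple_graph G \<and> graph_free H G \<and> card (verts G) > 1 \<longrightarrow>
      (\<exists>A B. pure_pair G A B \<and>
             real (card A) \<ge> \<epsilon> * real (card (verts G)) powr \<epsilon> \<and>
             real (card B) \<ge> \<epsilon> * real (card (verts G))))"
proof -
  define m :: real where "m = (64 * 8192)^2"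
  define \<epsilon> :: real where "\<epsilon> = 1 / m"
  have e: "0 < \<epsilon>" "\<epsilon> \<le> 1 / 12" "\<epsilon> \<le> 1 / 8192" unfolding \<epsilon>_def m_def by simp_all
  have "\<exists>A B. pure_pair G A B \<and> real (card A) \<ge> \<epsilon> * real (card (verts G)) powr \<epsilon> \<and>
      real (card B) \<ge> \<epsilon> * real (card (verts G))"
    if G: "finite_simple_graph G" "graph_free H G" "card (verts G) > 1" for G :: "'a ugraph"
  proof -
    define n where "n = card (verts G)"
    have n: "1 < n" using G n_def by simp
    have pw: "real n powr \<epsilon> \<le> real n" using n e powr_mono[of \<epsilon> 1 "real n"] by simp
    show ?thesis
    proof (cases "real n \<le> m")
      \<comment> \<open>Both bounds are at most 1, so two single vertices suffice.\<close>
      case True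
      then have le: "\<epsilon> * real n \<le> 1" unfolding \<epsilon>_def m_def by simp
      have "\<not> card (verts G) \<le> 1" using G by simp
      then obtain u v where uv: "u \<in> verts G" "v \<in> verts G" "u \<noteq> v"
        using card_le_Suc0_iff_eq[of "verts G"] G(1) unfolding finite_simple_graph_def by auto
      have "pure_pair G {u} {v}"
        using uv unfolding pure_pair_def complete_to_def anticomplete_to_def by auto
      moreover have "\<epsilon> * real n powr \<epsilon> \<le> 1"
        using le mult_left_mono[OF pw, of \<epsilon>] e by linarith
      ultimately show ?thesis using le
        by (intro exI[of _ "{u}"] exI[of _ "{v}"]) (simp add: n_def)
    next
      case False
      define t where "t = nat \<lceil>\<epsilon> * real n powr \<epsilon>\<rceil>"
      have pos: "0 < \<epsilon> * real n powr \<epsilon>" using e n by simp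
      have tl: "\<epsilon> * real n powr \<epsilon> \<le> real t" unfolding t_def by linarith
      have "\<epsilon> * real n powr \<epsilon> \<le> 1 * real n powr \<epsilon>" using e by (intro mult_right_mono) auto
      then have "real t \<le> 1 + real n powr \<epsilon>" using pos unfolding t_def by linarith
      then have t6: "8192 * t^6 \<le> card (verts G)"
        using sixth_power_bound[OF e(1,2), of n t] False unfolding m_def n_def by simp
      have "1 \<le> t" using tl pos by (cases t) auto
      then obtain A B where AB: "pure_pair G A B" "t \<le> card A" "n \<le> 8192 * card B"
        using pure_pair_if_free[OF G(1) _ _ t6] G(2) assms unfolding n_def by blast
      have "\<epsilon> * real n \<le> 1 / 8192 * real n" using e by (intro mult_right_mono) auto
      then have "\<epsilon> * real n \<le> real (card B)" using AB(3) by linarith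
      moreover have "\<epsilon> * real n powr \<epsilon> \<le> real (card A)" using tl AB(2) by linarith
      ultimately show ?thesis using AB(1) unfolding n_def by blast
    qed
  qed
  then show ?thesis using e(1) by blast
qed

end
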